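(* For $n\in\mathbb N$, let $$d_n^A=\max_{\mu\in\mathcal M(\{0,1\}^{\mathbb Z})}\mathbb P_\mu\big(A_{0,n}A_{1,n}\in\{00,11\}\big),$$ where under $\mathbb P_\mu$ the process $(A_n)_{n\in\mathbb N}$, $A_n=(A_{i,n})_{i\in\mathbb Z}$, is a realization of model $A$ with $A_0\sim\mu$, and let $d_n=4^{-n}\binom{2n+1}{n}$. Then for all $n\ge1$, $$\tfrac12\,d_{n-1}\le d_n^A\le d_n .$$
   Context: $\mathbb N=\{0,1,2,\dots\}$, $\mathcal U=\{\uparrow,\rightarrow\}$, and $\mathcal M(\cdot)$ denotes the set of Borel probability measures. An update process is a family $U=(U_{i,n})_{(i,n)\in\mathbb Z\times\mathbb N}$ of i.i.d. random variables with $\mathbb P(U_{i,n}=\uparrow)=\mathbb P(U_{i,n}=\rightarrow)=1/2$; write $U_n=(U_{i,n})_{i\in\mathbb Z}$. Model $A$: define $\mathcal A:\{0,1\}^{\mathbb Z}\times\mathcal U^{\mathbb Z}\to\{0,1\}^{\mathbb Z}$ by $\mathcal A(x,u)=\tilde x$ with $\tilde x_i=0$ if $x_{i-1}x_i=01$ or $(x_{i-1}x_i,u_i)\in\{(00,\rightarrow),(11,\uparrow)\}$, and $\tilde x_i=1$ if $x_{i-1}x_i=10$ or $(x_{i-1}x_i,u_i)\in\{(00,\uparrow),(11,\rightarrow)\}$. A realization of model $A$ is a process $(A_n)_{n\in\mathbb N}$ with $A_{n+1}=\mathcal A(A_n,U_n)$ for all $n$, where $U$ is an update process independent of $A_0$.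 *)

theory Defs
  imports "HOL-Probability.Probability"
begin

text \<open>Configurations in $\{0,1\}^{\mathbb Z}$: \<open>False\<close> encodes 0, \<open>True\<close> encodes 1.  The type
  carries the product topology, so \<open>borel :: config measure\<close> is its Borel sigma-algebra.\<close>

type_synonym config = "int \<Rightarrow> bool"

datatype update = Up | Right

definition update_process :: "'w measure \<Rightarrow> (int \<times> nat \<Rightarrow> 'w \<Rightarrow> update) \<Rightarrow> bool" where
  "update_process M U \<longleftrightarrow>
     prob_space M \<and>
     prob_space.indep_vars M (\<lambda>_. count_space UNIV) U UNIV \<and>
     (\<forall>k. measure M {\<omega> \<in> space M. U k \<omega> = Up} = 1 / 2 \<and>
          measure M {\<omega> \<in> space M. U k \<omega> = Right} = 1 / 2)"

definition step_A :: "config \<Rightarrow> (int \<Rightarrow> update) \<Rightarrow> config" where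
  "step_A x u = (\<lambda>i. case (x (i - 1), x i) of
       (False, True) \<Rightarrow> False
     | (True, False) \<Rightarrow> True
     | (False, False) \<Rightarrow> (case u i of Right \<Rightarrow> False | Up \<Rightarrow> True)
     | (True, True) \<Rightarrow> (case u i of Up \<Rightarrow> False | Right \<Rightarrow> True))"

text \<open>\<open>indep_var\<close> relates random elements of one and the same type only, so independence of $A_0$
  from the whole field $U$ is expressed by \<open>indep_set\<close> for the two generated sigma-algebras.\<close>

definition indep_of_updates :: "'w measure \<Rightarrow> ('w \<Rightarrow> config) \<Rightarrow> (int \<times> nat \<Rightarrow> 'w \<Rightarrow> update) \<Rightarrow> bool" where
  "indep_of_updates M X U \<longleftrightarrow>
     prob_space.indep_set M
       {X -` S \<inter> space M | S. S \<in> sets borel}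
       {(\<lambda>\<omega> k. U k \<omega>) -` T \<inter> space M | T. T \<in> sets (Pi\<^sub>M UNIV (\<lambda>_. count_space UNIV))}"

definition realization_A :: "'w measure \<Rightarrow> (nat \<Rightarrow> 'w \<Rightarrow> config) \<Rightarrow> bool" where
  "realization_A M A \<longleftrightarrow>
     (\<exists>U. update_process M U \<and>
          A 0 \<in> M \<rightarrow>\<^sub>M borel \<and>
          indep_of_updates M (A 0) U \<and>
          (\<forall>n. \<forall>\<omega>\<in>space M. A (Suc n) \<omega> = step_A (A n \<omega>) (\<lambda>i. U (i, n) \<omega>)))"

definition borel_prob_measures :: "config measure set" where
  "borel_prob_measures = {\<mu>. prob_space \<mu> \<and> sets \<mu> = sets borel}"

text \<open>HOL cannot quantify over all types of sample points, so the sample space is taken over the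
  type of pairs (initial configuration, update field).  This is no restriction: the law of a
  realization is determined by the initial law \<open>\<mu>\<close>, and for every \<open>\<mu>\<close> the product of \<open>\<mu>\<close> with the
  law of an update process carries one.\<close>

type_synonym sample = "config \<times> (int \<times> nat \<Rightarrow> update)"

definition agreement_probs_A :: "nat \<Rightarrow> real set" where
  "agreement_probs_A n =
     {measure M {\<omega> \<in> space M. (A n \<omega> 0, A n \<omega> 1) \<in> {(False, False), (True, True)}} |
        (\<mu> :: config measure) (M :: sample measure) A.
        \<mu> \<in> borel_prob_measures \<and> realization_A M A \<and> distr M borel (A 0) = \<mu>}"

text \<open>\<open>GREATEST\<close> is meaningful only if the maximum is attained, which is part of the claim.\<close>

definition d_A :: "nat \<Rightarrow> real" where
  "d_A n = (GREATEST p. p \<in> agreement_probs_A n)"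

definition d_seq :: "nat \<Rightarrow> real" where
  "d_seq n = real ((2 * n + 1) choose n) / 4 ^ n"

end

theory Submission
  imports Defs
begin

text \<open>Adding the parity of \<open>i + n\<close> to the state of site \<open>i\<close> at time \<open>n\<close> turns model A into a voter
  model: a site copies its left neighbour if the update is \<open>Right\<close> and keeps its value otherwise.
  Hence the value at \<open>(i, n)\<close> is the initial value at an ancestor, reached by a backward random walk,
  and sites 0 and 1 agree in model A iff the twisted values at their two ancestors differ.  The two
  ancestral walks are independent until they coalesce, and the probability that they have not met
  by time \<open>n\<close> is \<open>d_n\<close>; this is the upper bound.  From the constant initial configuration the twisted
  values are the parities of the sites, and the last backward step makes the parities of two
  uncoalesced ancestors independent and fair; this is the lower bound.  The agreement probability
  is a convex combination over the finitely many initial patterns on \<open>{-n..1}\<close>, so the maximum is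
  attained by a deterministic initial configuration.\<close>

section \<open>Backward walks and the parity twist\<close>

text \<open>The update \<open>u (i, n)\<close> acts between times \<open>n\<close> and
  \<open>Suc n\<close>, so tracing back from \<open>Suc n\<close> reads level \<open>n\<close> first
  and only lower levels afterwards.\<close>

fun anc :: "(int \<times> nat \<Rightarrow> update) \<Rightarrow> nat \<Rightarrow> int \<Rightarrow> int" where
  "anc u 0 i = i"
| "anc u (Suc n) i = anc u n (if u (i, n) = Right then i - 1 else i)"

text \<open>Model A copies \<open>x (i - 1)\<close> under \<open>Right\<close> and negates
  \<open>x i\<close> under \<open>Up\<close>; on unequal neighbours both rules agree. The parity is
  unchanged from \<open>(i - 1, n)\<close> to \<open>(i, Suc n)\<close> and flips from
  \<open>(i, n)\<close> to \<open>(i, Suc n)\<close>, which absorbs the negation.\<close>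

lemma step_A_twisted:
  "(step_A x u i \<noteq> odd (i + int (Suc n))) \<longleftrightarrow>
   (x (if u i = Right then i - 1 else i) \<noteq> odd ((if u i = Right then i - 1 else i) + int n))"
  by (cases "u i"; cases "x i"; cases "x (i - 1)") (auto simp: step_A_def)

lemma trajectory_twisted:
  assumes "\<And>n. X (Suc n) = step_A (X n) (\<lambda>i. u (i, n))"
  shows "(X n i \<noteq> odd (i + int n)) \<longleftrightarrow> (X 0 (anc u n i) \<noteq> odd (anc u n i))"
proof (induction n arbitrary: i)
  case (Suc n)
  show ?case
    using Suc.IH[of "if u (i, n) = Right then i - 1 else i"]
    unfolding assms step_A_twisted by simp
qed simp

lemma anc_bounds: "anc u n i \<in> {i - int n..i}"
proof (induction n arbitrary: i)
  case (Suc n)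
  show ?case
    using Suc.IH[of "if u (i, n) = Right then i - 1 else i"] by (auto split: if_splits)
qed simp

lemma anc_cong: "(\<And>i k. k < n \<Longrightarrow> u (i, k) = v (i, k)) \<Longrightarrow> anc u n i = anc v n i"
  by (induction n arbitrary: i) auto

text \<open>The index set \<open>B\<close> is left general to cover both the whole update field and
  its restriction to the levels below \<open>n\<close>.\<close>

lemma measurable_anc:
  assumes "UNIV \<times> {..<n} \<subseteq> B"
  shows "(\<lambda>u. anc u n i) \<in> Pi\<^sub>M B (\<lambda>_. count_space UNIV) \<rightarrow>\<^sub>M count_space UNIV"
  using assms
proof (induction n arbitrary: i)
  case (Suc n)
  have "(i, n) \<in> B" "UNIV \<times> {..<n} \<subseteq> B"
    using Suc.prems by auto
  then have [measurable]: "(\<lambda>u. u (i, n)) \<in> Pi\<^sub>M B (\<lambda>_. count_space UNIV) \<rightarrow>\<^sub>M count_space UNIV"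
    "\<And>i. (\<lambda>u. anc u n i) \<in> Pi\<^sub>M B (\<lambda>_. count_space UNIV) \<rightarrow>\<^sub>M count_space UNIV"
    using Suc.IH by (auto intro: measurable_component_singleton)
  have "(\<lambda>u. if u (i, n) = Right then anc u n (i - 1) else anc u n i)
      \<in> Pi\<^sub>M B (\<lambda>_. count_space UNIV) \<rightarrow>\<^sub>M count_space UNIV"
    by measurable
  also have "(\<lambda>u. if u (i, n) = Right then anc u n (i - 1) else anc u n i) = (\<lambda>u. anc u (Suc n) i)"
    by auto
  finally show ?case .
qed simp

section \<open>The splitting recursion and its comparison with binomial sums\<close>

text \<open>Probability that exactly one of the walks from \<open>i\<close> and \<open>j\<close>
  ends in \<open>W\<close>, computed by conditioning on the first backward step of both. Walks at
  the same site have coalesced, hence the value 0.\<close>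

fun split_prob :: "int set \<Rightarrow> nat \<Rightarrow> int \<Rightarrow> int \<Rightarrow> real" where
  "split_prob W 0 i j = (if (i \<in> W) \<noteq> (j \<in> W) then 1 else 0)"
| "split_prob W (Suc n) i j = (if i = j then 0 else
     (split_prob W n i j + split_prob W n (i - 1) j + split_prob W n i (j - 1)
       + split_prob W n (i - 1) (j - 1)) / 4)"

text \<open>Each walk moves left by at most one per step, so walks can meet but never cross, and all
  positions stay in the given interval.\<close>

lemma split_prob_cong:
  assumes "i \<le> j" "\<And>k. k \<in> {i - int n..j} \<Longrightarrow> k \<in> V \<longleftrightarrow> k \<in> W"
  shows "split_prob V n i j = split_prob W n i j"
  using assms
proof (induction n arbitrary: i j)
  case (Suc n)
  show ?case
  proof (cases "i = j")
    case False
    have "split_prob V n i' j' = split_prob W n i' j'" if "i' \<in> {i - 1, i}" "j' \<in> {j - 1, j}" for i' j'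
      using that False Suc.prems(1) by (intro Suc.IH Suc.prems(2)) auto
    then show ?thesis
      by simp
  qed simp
qed simp

text \<open>The difference of two independent walks moves like two steps of a simple random walk \<open>S\<close> with
  step \<open>1 / 2\<close>.  By reflection, it avoids 0 for time \<open>n\<close> from \<open>k\<close> with probability
  \<open>P (- k < S \<le> k)\<close> at step \<open>2 n\<close>; pairing the terms \<open>r\<close> and \<open>1 - r\<close> gives the sum below.\<close>

definition survival :: "nat \<Rightarrow> nat \<Rightarrow> real" where
  "survival n k = (\<Sum>r = 1..k. real ((2 * n + 1) choose (n + r))) / 4 ^ n"

lemma survival_0_right [simp]: "survival n 0 = 0"
  by (simp add: survival_def)

lemma survival_0_left: "k > 0 \<Longrightarrow> survival 0 k = 1"
proof -
  assume "k > 0"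
  then have "(\<Sum>r = 1..k. real (1 choose r)) = (\<Sum>r \<in> {1}. real (1 choose r))"
    by (intro sum.mono_neutral_right) (auto simp: binomial_eq_0)
  then show ?thesis
    by (simp add: survival_def)
qed

lemma survival_1: "survival n (Suc 0) = d_seq n"
  using binomial_symmetric[of n "2 * n + 1"] by (simp add: survival_def d_seq_def)

text \<open>First-step equation of the difference walk, with steps -1, 0, 1 of weights 1/4, 1/2,
  1/4. It comes from applying Pascal's rule twice to each summand.\<close>

lemma survival_Suc:
  "survival (Suc n) (Suc k) =
    (survival n k + 2 * survival n (Suc k) + survival n (Suc (Suc k))) / 4"
proof -
  have sym: "(2 * n + 1) choose n = (2 * n + 1) choose (Suc n)"
    using binomial_symmetric[of n "2 * n + 1"] by simp
  define c where "c r = real ((2 * n + 1) choose (n + r))" for r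
  have pascal: "real ((2 * Suc n + 1) choose (Suc n + Suc r)) = c r + 2 * c (Suc r) + c (Suc (Suc r))"
    for r
    by (simp add: c_def)
  \<comment> \<open>The boundary term: symmetry of the binomial row plays the part of the reflection
    at 0.\<close>
  have sym_c: "c 0 = c (Suc 0)"
    using sym by (simp add: c_def)
  have "(\<Sum>r = 1..Suc k. real ((2 * Suc n + 1) choose (Suc n + r))) =
      (\<Sum>r = 1..k. c r) + 2 * (\<Sum>r = 1..Suc k. c r) + (\<Sum>r = 1..Suc (Suc k). c r)"
  proof (induction k)
    case 0
    show ?case
      using pascal[of 0] sym_c by simp
  next
    case (Suc k)
    then show ?case
      using pascal[of "Suc k"] by simp
  qed
  moreover have "survival n l = (\<Sum>r = 1..l. c r) / 4 ^ n" for l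
    by (simp only: survival_def c_def)
  ultimately show ?thesis
    unfolding survival_def[of "Suc n"] by (simp only: power_Suc) (simp add: add_divide_distrib)
qed

text \<open>Both sides vanish on the diagonal and obey the same recursion off it; at time 0, ending
  on different sides of \<open>W\<close> forces distinct sites.\<close>

lemma split_prob_le_survival: "i \<le> j \<Longrightarrow> split_prob W n i j \<le> survival n (nat (j - i))"
proof (induction n arbitrary: i j)
  case 0
  then show ?case by (cases "i = j") (auto simp: survival_0_left)
next
  case (Suc n)
  show ?case
  proof (cases "i = j")
    case False
    \<comment> \<open>The smallest gap after one step; the four successor gaps are
      \<open>k + 1\<close>, \<open>k + 2\<close>, \<open>k\<close> and \<open>k + 1\<close>.\<close>
    define k where "k = nat (j - i - 1)"
    have k: "nat (j - i) = Suc k" "nat (j - (i - 1)) = Suc (Suc k)" "nat (j - 1 - i) = k"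
      "nat (j - 1 - (i - 1)) = Suc k"
      using False Suc.prems by (auto simp: k_def)
    show ?thesis
      using Suc.IH[of i j] Suc.IH[of "i - 1" j] Suc.IH[of i "j - 1"] Suc.IH[of "i - 1" "j - 1"]
        False Suc.prems
      unfolding k by (simp add: k survival_Suc)
  qed simp
qed

text \<open>The induction starts at level \<open>Suc 0\<close>: from distinct sites, two of the four
  moves give different parities, whence the factor 1/2. The recursions then coincide, one level
  apart.\<close>

lemma split_prob_odd: "i \<le> j \<Longrightarrow> split_prob {i. odd i} (Suc n) i j = survival n (nat (j - i)) / 2"
proof (induction n arbitrary: i j)
  case 0
  then show ?case by (cases "i = j") (auto simp: survival_0_left)
next
  case (Suc n)
  show ?case
  proof (cases "i = j")
    case False
    define k where "k = nat (j - i - 1)"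
    have k: "nat (j - i) = Suc k" "nat (j - (i - 1)) = Suc (Suc k)" "nat (j - 1 - i) = k"
      "nat (j - 1 - (i - 1)) = Suc k"
      using False Suc.prems by (auto simp: k_def)
    have "i \<le> j" "i - 1 \<le> j" "i \<le> j - 1" "i - 1 \<le> j - 1"
      using False Suc.prems by auto
    note IH = this[THEN Suc.IH, unfolded k]
    show ?thesis
      unfolding split_prob.simps(2)[of _ "Suc n"] IH k survival_Suc using False by (simp add: field_simps)
  qed simp
qed

section \<open>The joint law of two ancestors\<close>

lemma UNIV_update: "(UNIV :: update set) = {Up, Right}"
  using update.exhaust by auto

lemma finite_UNIV_update [simp]: "finite (UNIV :: update set)"
  by (simp add: UNIV_update)

lemma card_UNIV_update [simp]: "card (UNIV :: update set) = 2"
  by (simp add: UNIV_update)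

lemma update_process_measurable:
  assumes "update_process M U"
  shows "U k \<in> M \<rightarrow>\<^sub>M count_space UNIV"
proof -
  interpret prob_space M
    using assms by (simp add: update_process_def)
  show ?thesis
    using assms unfolding update_process_def indep_vars_def by blast
qed

lemma measurable_anc_update_process:
  assumes "update_process M U"
  shows "(\<lambda>\<omega>. anc (\<lambda>k. U k \<omega>) n i) \<in> M \<rightarrow>\<^sub>M count_space UNIV"
  by (rule measurable_compose[OF measurable_PiM_single' measurable_anc[of n UNIV i]])
    (use update_process_measurable[OF assms] in auto)

lemma prob_two_updates:
  assumes "update_process M U" "k \<noteq> l"
  shows "measure M {\<omega> \<in> space M. U k \<omega> = a \<and> U l \<omega> = b} = 1 / 4"
proof -
  interpret prob_space M
    using assms by (simp add: update_process_def)
  have ind: "indep_vars (\<lambda>_. count_space UNIV) U UNIV"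
    using assms by (simp add: update_process_def)
  have half: "prob (U k -` {c} \<inter> space M) = 1 / 2" for k c
  proof -
    have "U k -` {c} \<inter> space M = {\<omega> \<in> space M. U k \<omega> = c}"
      by auto
    then show ?thesis
      using assms(1) by (cases c) (simp_all add: update_process_def del: split_paired_All)
  qed
  have "prob (\<Inter>m\<in>{k, l}. U m -` (if m = k then {a} else {b}) \<inter> space M) =
      (\<Prod>m\<in>{k, l}. prob (U m -` (if m = k then {a} else {b}) \<inter> space M))"
    by (rule indep_varsD[OF ind]) auto
  also have "\<dots> = 1 / 4"
    using assms(2) by (simp add: half del: split_paired_All)
  also have "(\<Inter>m\<in>{k, l}. U m -` (if m = k then {a} else {b}) \<inter> space M) =
      {\<omega> \<in> space M. U k \<omega> = a \<and> U l \<omega> = b}"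
    using assms(2) by auto
  finally show ?thesis .
qed

text \<open>The first backward step reads level \<open>n\<close>, the rest only lower levels, so the
  two are independent. For distinct sites the two coins of the first step are independent as well;
  equal sites share one ancestor.\<close>

lemma prob_anc_split:
  assumes "update_process M U"
  shows "measure M {\<omega> \<in> space M. (anc (\<lambda>k. U k \<omega>) n i \<in> W) \<noteq> (anc (\<lambda>k. U k \<omega>) n j \<in> W)} =
    split_prob W n i j"
proof -
  interpret prob_space M
    using assms by (simp add: update_process_def)
  have ind: "indep_vars (\<lambda>_. count_space UNIV) U UNIV"
    using assms by (simp add: update_process_def)
  note [measurable] = update_process_measurable[OF assms] measurable_anc_update_process[OF assms]
  define E where "E n i j =
    {\<omega> \<in> space M. (anc (\<lambda>k. U k \<omega>) n i \<in> W) \<noteq> (anc (\<lambda>k. U k \<omega>) n j \<in> W)}" for n i j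
  have E_sets [measurable]: "E n i j \<in> sets M" for n i j
    unfolding E_def by measurable
  have "prob (E n i j) = split_prob W n i j"
  proof (induction n arbitrary: i j)
    case 0
    show ?case by (auto simp: E_def prob_space)
  next
    case (Suc n)
    show ?case
    proof (cases "i = j")
      case True
      then show ?thesis by (simp add: E_def)
    next
      case False
      define sh where "sh i a = (if a = Right then i - 1 else i)" for i :: int and a
      define D where "D a b = {\<omega> \<in> space M. U (i, n) \<omega> = a \<and> U (j, n) \<omega> = b}" for a b
      have [measurable]: "D a b \<in> sets M" for a b
        unfolding D_def by measurable
      have indep: "prob (D a b \<inter> E n i' j') = split_prob W n i' j' / 4" for a b i' j'
      proof -
        let ?K = "{(i, n), (j, n)}" and ?L = "UNIV \<times> {..<n} :: (int \<times> nat) set"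
        let ?P = "\<lambda>B. Pi\<^sub>M B (\<lambda>_. count_space (UNIV :: update set))"
        let ?D = "{u \<in> space (?P ?K). u (i, n) = a \<and> u (j, n) = b}"
        let ?E = "{u \<in> space (?P ?L). (anc u n i' \<in> W) \<noteq> (anc u n j' \<in> W)}"
        note [measurable] = measurable_anc[of n ?L, OF subset_refl]
        have restr: "anc (restrict (\<lambda>k. U k \<omega>) ?L) n m = anc (\<lambda>k. U k \<omega>) n m" for \<omega> m
          by (rule anc_cong) auto
        have "indep_var (?P ?K) (\<lambda>\<omega>. restrict (\<lambda>k. U k \<omega>) ?K) (?P ?L) (\<lambda>\<omega>. restrict (\<lambda>k. U k \<omega>) ?L)"
          by (rule indep_var_restrict[OF ind]) auto
        moreover have "?D \<in> sets (?P ?K)" "?E \<in> sets (?P ?L)"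
          by measurable
        ultimately have "prob ((\<lambda>\<omega>. (restrict (\<lambda>k. U k \<omega>) ?K, restrict (\<lambda>k. U k \<omega>) ?L)) -` (?D \<times> ?E) \<inter> space M) =
            prob ((\<lambda>\<omega>. restrict (\<lambda>k. U k \<omega>) ?K) -` ?D \<inter> space M) *
            prob ((\<lambda>\<omega>. restrict (\<lambda>k. U k \<omega>) ?L) -` ?E \<inter> space M)"
          by (rule indep_varD)
        moreover have "(\<lambda>\<omega>. restrict (\<lambda>k. U k \<omega>) ?K) -` ?D \<inter> space M = D a b"
          by (auto simp: D_def space_PiM)
        moreover have "(\<lambda>\<omega>. restrict (\<lambda>k. U k \<omega>) ?L) -` ?E \<inter> space M = E n i' j'"
          by (auto simp: E_def space_PiM restr)
        moreover have "(\<lambda>\<omega>. (restrict (\<lambda>k. U k \<omega>) ?K, restrict (\<lambda>k. U k \<omega>) ?L)) -` (?D \<times> ?E) \<inter> space M =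
            D a b \<inter> E n i' j'"
          by (auto simp: D_def E_def space_PiM restr)
        moreover have "prob (D a b) = 1 / 4"
          using prob_two_updates[OF assms, of "(i, n)" "(j, n)"] False by (simp add: D_def)
        ultimately show ?thesis
          using Suc.IH by simp
      qed
      define S where "S = (UNIV :: (update \<times> update) set)"
      have S: "S = {(Up, Up), (Up, Right), (Right, Up), (Right, Right)}"
        unfolding S_def UNIV_Times_UNIV[symmetric] UNIV_update by auto
      \<comment> \<open>Partition by the values of the two coins at level \<open>n\<close>.\<close>
      have "E (Suc n) i j = (\<Union>(a, b)\<in>S. D a b \<inter> E n (sh i a) (sh j b))"
      proof (rule set_eqI)
        fix \<omega>
        have "\<omega> \<in> E (Suc n) i j \<longleftrightarrow>
            \<omega> \<in> space M \<and> \<omega> \<in> E n (sh i (U (i, n) \<omega>)) (sh j (U (j, n) \<omega>))"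
          by (simp add: E_def sh_def)
        then show "\<omega> \<in> E (Suc n) i j \<longleftrightarrow> \<omega> \<in> (\<Union>(a, b)\<in>S. D a b \<inter> E n (sh i a) (sh j b))"
          by (simp add: S_def D_def del: split_paired_All)
      qed
      also have "prob \<dots> = (\<Sum>(a, b)\<in>S. prob (D a b \<inter> E n (sh i a) (sh j b)))"
        unfolding case_prod_unfold
        by (rule finite_measure_finite_Union) (auto simp: S D_def disjoint_family_on_def)
      also have "\<dots> = split_prob W (Suc n) i j"
        using False by (simp add: indep S sh_def)
      finally show ?thesis .
    qed
  qed
  then show ?thesis
    by (simp add: E_def)
qed

section \<open>The agreement probability as a mixture over initial patterns\<close>

text \<open>The window contains every possible time-0 ancestor of the sites 0 and 1 at time
  \<open>n\<close>, and it admits only finitely many patterns.\<close>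

definition twisted_pattern :: "nat \<Rightarrow> config \<Rightarrow> int set" where
  "twisted_pattern n x = {i \<in> {- int n..1}. x i \<noteq> odd i}"

text \<open>At equal times the sites 0 and 1 carry opposite parities, so equal states mean different
  twisted values.\<close>

lemma realization_agreement_iff:
  assumes "\<And>n. X (Suc n) = step_A (X n) (\<lambda>i. u (i, n))"
  shows "(X n 0, X n 1) \<in> {(False, False), (True, True)} \<longleftrightarrow>
    (anc u n 0 \<in> twisted_pattern n (X 0)) \<noteq> (anc u n 1 \<in> twisted_pattern n (X 0))"
  using trajectory_twisted[of X u n 0, OF assms] trajectory_twisted[of X u n 1, OF assms]
    anc_bounds[of u n 0] anc_bounds[of u n 1]
  by (auto simp: twisted_pattern_def)

lemma measurable_coordinate: "(\<lambda>x :: config. x i) \<in> borel \<rightarrow>\<^sub>M count_space UNIV"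
proof -
  have "(\<lambda>x :: config. x i) \<in> borel \<rightarrow>\<^sub>M borel"
    by (intro borel_measurable_continuous_onI continuous_on_product_coordinates)
  then show ?thesis
    using measurable_cong_sets[OF refl sets_borel_eq_count_space] by blast
qed

text \<open>Given the initial pattern \<open>S\<close>, agreement is an event of the updates alone;
  independence of \<open>A 0\<close> and the updates factors each term.\<close>

lemma agreement_prob_mixture:
  assumes real: "realization_A M A"
  shows "measure M {\<omega> \<in> space M. (A n \<omega> 0, A n \<omega> 1) \<in> {(False, False), (True, True)}} =
    (\<Sum>S\<in>Pow {- int n..1}. measure M {\<omega> \<in> space M. twisted_pattern n (A 0 \<omega>) = S} * split_prob S n 0 1)"
    (is "measure M ?G = (\<Sum>S\<in>?I. measure M (?H S) * _)")
    and "(\<Sum>S\<in>Pow {- int n..1}. measure M {\<omega> \<in> space M. twisted_pattern n (A 0 \<omega>) = S}) = 1"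
proof -
  obtain U where U: "update_process M U" and A0: "A 0 \<in> M \<rightarrow>\<^sub>M borel"
    and indep: "indep_of_updates M (A 0) U"
    and step: "\<And>n \<omega>. \<omega> \<in> space M \<Longrightarrow> A (Suc n) \<omega> = step_A (A n \<omega>) (\<lambda>i. U (i, n) \<omega>)"
    using real unfolding realization_A_def by blast
  interpret prob_space M
    using U by (simp add: update_process_def)
  have pat: "{x. twisted_pattern n x = S} \<in> sets borel" for S
  proof -
    note [measurable] = measurable_coordinate
    \<comment> \<open>A condition on finitely many coordinates; if \<open>S\<close> leaves the
      window the event is empty.\<close>
    have "{x. twisted_pattern n x = S} =
        {x \<in> space borel. S \<subseteq> {- int n..1} \<and> (\<forall>i\<in>{- int n..1}. (x i \<noteq> odd i) = (i \<in> S))}"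
      by (auto simp: twisted_pattern_def)
    also have "\<dots> \<in> sets borel"
      by measurable
    finally show ?thesis .
  qed
  have H_vimage: "?H S = A 0 -` {x. twisted_pattern n x = S} \<inter> space M" for S
    by auto
  have H: "?H S \<in> sets M" for S
    unfolding H_vimage using A0 pat by (rule measurable_sets)
  define E where "E S =
    {\<omega> \<in> space M. (anc (\<lambda>k. U k \<omega>) n 0 \<in> S) \<noteq> (anc (\<lambda>k. U k \<omega>) n 1 \<in> S)}" for S
  have E: "E S \<in> sets M" for S
    using measurable_anc_update_process[OF U, measurable] unfolding E_def by measurable
  have "prob (?H S \<inter> E S) = prob (?H S) * prob (E S)" for S
  proof (rule indep_setD[OF indep[unfolded indep_of_updates_def]])
    show "?H S \<in> {A 0 -` S \<inter> space M |S. S \<in> sets borel}"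
      unfolding H_vimage using pat[of S] by (intro CollectI exI[of _ "{x. twisted_pattern n x = S}"] conjI refl)
    let ?P = "Pi\<^sub>M UNIV (\<lambda>_. count_space (UNIV :: update set))"
    let ?T = "{u \<in> space ?P. (anc u n 0 \<in> S) \<noteq> (anc u n 1 \<in> S)}"
    have "?T \<in> sets ?P"
      using measurable_anc[of n UNIV, measurable] by measurable
    moreover have "E S = (\<lambda>\<omega> k. U k \<omega>) -` ?T \<inter> space M"
      by (auto simp: E_def space_PiM)
    ultimately show "E S \<in> {(\<lambda>\<omega> k. U k \<omega>) -` T \<inter> space M |T. T \<in> sets ?P}"
      by (intro CollectI exI[of _ ?T] conjI)
  qed
  then have HE: "prob (?H S \<inter> E S) = prob (?H S) * split_prob S n 0 1" for S
    using prob_anc_split[OF U] by (simp add: E_def)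
  have mem: "twisted_pattern n x \<in> ?I" for x
    by (auto simp: twisted_pattern_def)
  have "?G = (\<Union>S\<in>?I. ?H S \<inter> E S)"
  proof -
    have "\<omega> \<in> ?G \<longleftrightarrow> \<omega> \<in> E (twisted_pattern n (A 0 \<omega>))" if "\<omega> \<in> space M" for \<omega>
      using realization_agreement_iff[of "\<lambda>n. A n \<omega>" "\<lambda>k. U k \<omega>" n] step that
      by (simp add: E_def)
    then show ?thesis
      using mem by (auto simp: E_def)
  qed
  also have "prob \<dots> = (\<Sum>S\<in>?I. prob (?H S \<inter> E S))"
    using H E by (intro finite_measure_finite_Union) (auto simp: disjoint_family_on_def)
  finally show "prob ?G = (\<Sum>S\<in>?I. prob (?H S) * split_prob S n 0 1)"
    by (simp add: HE)
  have "(\<Sum>S\<in>?I. prob (?H S)) = prob (\<Union>S\<in>?I. ?H S)"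
    using H by (intro finite_measure_finite_Union[symmetric]) (auto simp: disjoint_family_on_def)
  also have "(\<Union>S\<in>?I. ?H S) = space M"
    using mem by auto
  finally show "(\<Sum>S\<in>?I. prob (?H S)) = 1"
    by (simp add: prob_space)
qed

section \<open>Deterministic initial configurations\<close>

lemma ex_realization_A_const:
  fixes x :: config
  obtains M :: "sample measure" and A where "realization_A M A" "\<And>\<omega>. A 0 \<omega> = x"
proof -
  let ?C = "count_space (UNIV :: update set)"
  define coin where "coin = uniform_count_measure (UNIV :: update set)"
  have coin: "prob_space coin" "sets coin = sets ?C" "space coin = UNIV"
    unfolding coin_def
    by (auto intro!: prob_space_uniform_count_measure
        simp: sets_uniform_count_measure space_uniform_count_measure)
  have coin_half: "measure coin {c} = 1 / 2" for c
    unfolding coin_def by (subst measure_uniform_count_measure) simp_all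
  define N where "N = Pi\<^sub>M (UNIV :: (int \<times> nat) set) (\<lambda>_. coin)"
  \<comment> \<open>The fair-coin product \<open>N\<close> is pushed forward to pairs whose first
    component is always \<open>x\<close>.\<close>
  define M where "M = distr N ((borel :: config measure) \<Otimes>\<^sub>M N) (Pair x)"
  interpret N: prob_space N
    unfolding N_def by (intro prob_space_PiM coin)
  have Pair_meas [measurable]: "Pair x \<in> N \<rightarrow>\<^sub>M borel \<Otimes>\<^sub>M N"
    by measurable
  interpret M: prob_space M
    unfolding M_def by (intro N.prob_space_distr Pair_meas)
  define U where "U k \<omega> = snd \<omega> k" for k and \<omega> :: sample
  have comp: "(\<lambda>u. u k) \<in> N \<rightarrow>\<^sub>M ?C" for k
    using measurable_component_singleton[of k UNIV "\<lambda>_. coin"] coin(2) measurable_cong_sets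
    unfolding N_def by blast
  have U_meas: "U k \<in> M \<rightarrow>\<^sub>M ?C" for k
    using measurable_compose[OF measurable_snd comp] unfolding U_def M_def by simp
  have setsN: "sets N = sets (Pi\<^sub>M UNIV (\<lambda>_. ?C))"
    unfolding N_def by (intro sets_PiM_cong) (auto simp: coin)
  have marg: "distr M ?C (U k) = coin" for k
  proof -
    have "distr M ?C (U k) = distr N ?C (\<lambda>u. u k)"
      unfolding M_def by (subst distr_distr) (use U_meas in \<open>auto simp: M_def U_def comp_def\<close>)
    also have "\<dots> = distr N coin (\<lambda>u. u k)"
      by (intro distr_cong) (auto simp: coin)
    also have "\<dots> = coin"
      unfolding N_def by (intro distr_PiM_component coin) auto
    finally show ?thesis .
  qed
  have "M.indep_vars (\<lambda>_. ?C) U UNIV"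
  proof (subst M.indep_vars_iff_distr_eq_PiM)
    have "distr M (Pi\<^sub>M UNIV (\<lambda>_. ?C)) (\<lambda>\<omega>. \<lambda>k\<in>UNIV. U k \<omega>) = distr N (Pi\<^sub>M UNIV (\<lambda>_. ?C)) (\<lambda>u. u)"
      unfolding M_def
      by (subst distr_distr)
        (auto simp: U_def comp_def restrict_def space_PiM intro!: measurable_PiM_single' measurable_compose[OF measurable_snd comp])
    also have "\<dots> = N"
      by (rule distr_id2) (simp add: setsN)
    finally show "distr M (Pi\<^sub>M UNIV (\<lambda>_. ?C)) (\<lambda>\<omega>. \<lambda>k\<in>UNIV. U k \<omega>) = Pi\<^sub>M UNIV (\<lambda>k. distr M ?C (U k))"
      by (simp add: marg N_def)
  qed (use U_meas in auto)
  moreover have "measure M {\<omega> \<in> space M. U k \<omega> = c} = 1 / 2" for k c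
  proof -
    have "measure M {\<omega> \<in> space M. U k \<omega> = c} = measure (distr M ?C (U k)) {c}"
      by (subst measure_distr[OF U_meas]) (auto intro!: arg_cong[of _ _ "measure M"])
    then show ?thesis
      by (simp add: marg coin_half)
  qed
  ultimately have up: "update_process M U"
    by (simp add: update_process_def M.prob_space_axioms)
  define A where "A n \<omega> = rec_nat x (\<lambda>n y. step_A y (\<lambda>i. U (i, n) \<omega>)) n" for n \<omega>
  have A0: "A 0 = (\<lambda>_. x)"
    by (simp add: A_def fun_eq_iff)
  have "indep_of_updates M (A 0) U"
    unfolding indep_of_updates_def
  proof (rule M.indep_setI)
    have "(\<lambda>\<omega> k. U k \<omega>) \<in> M \<rightarrow>\<^sub>M Pi\<^sub>M UNIV (\<lambda>_. ?C)"
      by (rule measurable_PiM_single') (use U_meas in auto)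
    then show "{(\<lambda>\<omega> k. U k \<omega>) -` T \<inter> space M |T. T \<in> sets (Pi\<^sub>M UNIV (\<lambda>_. ?C))} \<subseteq> sets M"
      by (auto intro: measurable_sets)
    \<comment> \<open>A constant generates the trivial sigma-algebra, which is independent of
      everything.\<close>
    have trivial: "A 0 -` S \<inter> space M = (if x \<in> S then space M else {})" for S
      by (simp add: A0)
    then show "{A 0 -` S \<inter> space M |S. S \<in> sets borel} \<subseteq> sets M"
      by auto
    fix a b
    assume "a \<in> {A 0 -` S \<inter> space M |S. S \<in> sets borel}"
      and "b \<in> {(\<lambda>\<omega> k. U k \<omega>) -` T \<inter> space M |T. T \<in> sets (Pi\<^sub>M UNIV (\<lambda>_. ?C))}"
    then have "a = space M \<or> a = {}" "b \<subseteq> space M"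
      using trivial by (auto split: if_splits)
    then show "M.prob (a \<inter> b) = M.prob a * M.prob b"
      by (auto simp: M.prob_space Int_absorb1)
  qed
  then have "realization_A M A"
    unfolding realization_A_def using up by (intro exI[of _ U]) (auto simp: A0, simp add: A_def)
  then show thesis
    using that A0 by simp
qed

lemma split_prob_in_agreement_probs_A:
  assumes "S \<subseteq> {- int n..1}"
  shows "split_prob S n 0 1 \<in> agreement_probs_A n"
proof -
  \<comment> \<open>Undoes the parity twist, so the mixture puts all its weight on
    \<open>S\<close>.\<close>
  define x where "x i \<longleftrightarrow> (i \<in> S) \<noteq> odd i" for i
  have pat: "twisted_pattern n x = S"
    using assms by (auto simp: twisted_pattern_def x_def)
  obtain M :: "sample measure" and A where real: "realization_A M A" and A0: "\<And>\<omega>. A 0 \<omega> = x"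
    using ex_realization_A_const[of x] by blast
  have M: "prob_space M" "A 0 \<in> M \<rightarrow>\<^sub>M borel"
    using real by (auto simp: realization_A_def update_process_def)
  have "measure M {\<omega> \<in> space M. (A n \<omega> 0, A n \<omega> 1) \<in> {(False, False), (True, True)}} =
      (\<Sum>T\<in>Pow {- int n..1}. if T = S then split_prob S n 0 1 else 0)"
    unfolding agreement_prob_mixture(1)[OF real]
    by (intro sum.cong) (auto simp: A0 pat prob_space.prob_space[OF M(1)])
  also have "\<dots> = split_prob S n 0 1"
    using assms by simp
  finally have "measure M {\<omega> \<in> space M. (A n \<omega> 0, A n \<omega> 1) \<in> {(False, False), (True, True)}} =
      split_prob S n 0 1" .
  moreover have "distr M borel (A 0) \<in> borel_prob_measures"
    using M by (auto simp: borel_prob_measures_def intro: prob_space.prob_space_distr)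
  ultimately show ?thesis
    unfolding agreement_probs_A_def using real
    by (intro CollectI exI[of _ "distr M borel (A 0)"] exI[of _ M] exI[of _ A]) simp
qed

text \<open>A convex combination cannot exceed a common bound of its terms.\<close>

lemma agreement_probs_A_le:
  assumes "p \<in> agreement_probs_A n" and "\<And>S. S \<subseteq> {- int n..1} \<Longrightarrow> split_prob S n 0 1 \<le> c"
  shows "p \<le> c"
proof -
  obtain M :: "sample measure" and A where real: "realization_A M A"
    and p: "p = measure M {\<omega> \<in> space M. (A n \<omega> 0, A n \<omega> 1) \<in> {(False, False), (True, True)}}"
    using assms(1) unfolding agreement_probs_A_def by blast
  have "p \<le> (\<Sum>S\<in>Pow {- int n..1}. measure M {\<omega> \<in> space M. twisted_pattern n (A 0 \<omega>) = S} * c)"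
    unfolding p agreement_prob_mixture(1)[OF real]
    by (intro sum_mono mult_left_mono assms(2)) auto
  also have "\<dots> = c"
    using agreement_prob_mixture(2)[OF real] by (simp add: sum_distrib_right[symmetric])
  finally show ?thesis .
qed

section \<open>Attainment of the maximum and the two bounds\<close>

theorem proposition6p1:
  shows "(\<forall>n. d_A n \<in> agreement_probs_A n \<and> (\<forall>p \<in> agreement_probs_A n. p \<le> d_A n)) \<and>
         (\<forall>n\<ge>1. 1 / 2 * d_seq (n - 1) \<le> d_A n \<and> d_A n \<le> d_seq n)"
proof -
  have max: "d_A n \<in> agreement_probs_A n \<and> (\<forall>p \<in> agreement_probs_A n. p \<le> d_A n)" for n
  proof -
    \<comment> \<open>The values at deterministic patterns: each is attained, and their maximum
      bounds every mixture.\<close>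
    let ?V = "(\<lambda>S. split_prob S n 0 1) ` Pow {- int n..1}"
    have "Max ?V \<in> ?V"
      by (intro Max_in) auto
    then have mem: "Max ?V \<in> agreement_probs_A n"
      using split_prob_in_agreement_probs_A by auto
    have le: "p \<le> Max ?V" if "p \<in> agreement_probs_A n" for p
      using that by (rule agreement_probs_A_le) auto
    have "d_A n = Max ?V"
      unfolding d_A_def using mem le by (intro Greatest_equality)
    then show ?thesis
      using mem le by simp
  qed
  moreover have "1 / 2 * d_seq (n - 1) \<le> d_A n" if n1: "n \<ge> 1" for n
  proof -
    obtain m where n: "n = Suc m"
      using n1 by (cases n) auto
    \<comment> \<open>The twisted pattern of the all-0 configuration on the window;
      \<open>0 - int n\<close> matches the interval in \<open>split_prob_cong\<close>.\<close>
    let ?S = "{i. odd i} \<inter> {0 - int n..1}"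
    have "split_prob ?S n 0 1 = d_seq m / 2"
      using split_prob_cong[of 0 1 n ?S "{i. odd i}"] split_prob_odd[of 0 1 m] n
      by (simp add: survival_1 del: split_prob.simps)
    then show ?thesis
      using max[of n] split_prob_in_agreement_probs_A[of ?S n] n by auto
  qed
  moreover have "d_A n \<le> d_seq n" for n
    using max[of n, THEN conjunct1] split_prob_le_survival[of 0 1 _ n]
    by (elim agreement_probs_A_le) (simp add: survival_1)
  ultimately show ?thesis
    by blast
qed

end
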